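(* Let $A$ be an $n$-dimensional commutative algebra over a field $\mathbb{F}$ with $\operatorname{char}(\mathbb{F})\neq 2$. Assume that $A$ admits a multiplicative basis. Then there exist an $n^2$-dimensional evolution $\mathbb{F}$-algebra $B$ which itself admits a multiplicative basis, and an $\mathbb{F}$-algebra morphism $\varphi\colon A\longrightarrow B$ such that: (1) $\varphi$ is a monomorphism, that is, $A$ embeds into $B$; (2) $\varphi(A)$ is an ideal in $B$; (3) $B/\varphi(A)$ is degenerate.
   Context: An algebra over a field $\mathbb{F}$ is an $\mathbb{F}$-vector space with a bilinear multiplication, not assumed associative or unital. Algebra morphisms are linear multiplicative maps (not required to preserve a unit). An algebra $E$ over $\mathbb{F}$ is an evolution algebra if it admits a basis $\{e_i : i\in I\}$, called a natural basis, such that $e_ie_j=0$ whenever $i\neq j$. A basis of an algebra is multiplicative if the product of any two basis elements is a scalar multiple (possibly zero) of a basis element. The multiplicative basis of $B$ is not required to be a natural basis. Here an algebra is called degenerate if its multiplication is identically zero. *)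

theory Defs
  imports Complex_Main "HOL-Library.Function_Algebras"
begin

text \<open>
  Algebras over a field, neither associative nor unital in general. The underlying vector space
  is the subspace \<open>A\<close> of an ambient vector space, so that the dimension of an algebra is not tied
  to its type. Values of \<open>mul\<close> outside \<open>A\<close> are irrelevant.
\<close>

locale nonassoc_algebra = vector_space scale
  for scale :: "'f::field \<Rightarrow> 'v::ab_group_add \<Rightarrow> 'v" (infixr \<open>*s\<close> 75) +
  fixes A :: "'v set" and mul :: "'v \<Rightarrow> 'v \<Rightarrow> 'v" (infixl \<open>\<bullet>\<close> 70)
  assumes subspace_carrier: "subspace A"
    and mul_closed: "\<lbrakk>x \<in> A; y \<in> A\<rbrakk> \<Longrightarrow> x \<bullet> y \<in> A"
    and mul_add_left: "\<lbrakk>x \<in> A; y \<in> A; z \<in> A\<rbrakk> \<Longrightarrow> (x + y) \<bullet> z = x \<bullet> z + y \<bullet> z"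
    and mul_add_right: "\<lbrakk>x \<in> A; y \<in> A; z \<in> A\<rbrakk> \<Longrightarrow> x \<bullet> (y + z) = x \<bullet> y + x \<bullet> z"
    and mul_scale_left: "\<lbrakk>x \<in> A; y \<in> A\<rbrakk> \<Longrightarrow> (c *s x) \<bullet> y = c *s (x \<bullet> y)"
    and mul_scale_right: "\<lbrakk>x \<in> A; y \<in> A\<rbrakk> \<Longrightarrow> x \<bullet> (c *s y) = c *s (x \<bullet> y)"
begin

definition is_basis :: "'v set \<Rightarrow> bool" where
  "is_basis b \<longleftrightarrow> b \<subseteq> A \<and> independent b \<and> span b = A"

text \<open>Not \<open>dim A = n\<close>: the library's \<open>dim\<close> is \<open>0\<close> on infinite-dimensional spaces.\<close>

definition has_dimension :: "nat \<Rightarrow> bool" where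
  "has_dimension n \<longleftrightarrow> (\<exists>b. is_basis b \<and> finite b \<and> card b = n)"

definition natural_basis :: "'v set \<Rightarrow> bool" where
  "natural_basis b \<longleftrightarrow> is_basis b \<and> (\<forall>x\<in>b. \<forall>y\<in>b. x \<noteq> y \<longrightarrow> x \<bullet> y = 0)"

definition multiplicative_basis :: "'v set \<Rightarrow> bool" where
  "multiplicative_basis b \<longleftrightarrow>
     is_basis b \<and> (\<forall>x\<in>b. \<forall>y\<in>b. \<exists>z\<in>b. \<exists>c. x \<bullet> y = c *s z)"

definition ideal :: "'v set \<Rightarrow> bool" where
  "ideal I \<longleftrightarrow> I \<subseteq> A \<and> subspace I \<and> (\<forall>a\<in>A. \<forall>x\<in>I. a \<bullet> x \<in> I \<and> x \<bullet> a \<in> I)"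

definition quot_carrier :: "'v set \<Rightarrow> 'v set set" where
  "quot_carrier I = {(+) x ` I | x. x \<in> A}"

text \<open>The union of the cosets \<open>x \<bullet> y + I\<close> over all representatives; see \<open>quot_mul_coset\<close> below.\<close>

definition quot_mul :: "'v set \<Rightarrow> 'v set \<Rightarrow> 'v set \<Rightarrow> 'v set" where
  "quot_mul I X Y = (\<Union>x\<in>X. \<Union>y\<in>Y. (+) (x \<bullet> y) ` I)"

end

locale commutative_algebra = nonassoc_algebra +
  assumes mul_commute: "\<lbrakk>x \<in> A; y \<in> A\<rbrakk> \<Longrightarrow> x \<bullet> y = y \<bullet> x"

locale evolution_algebra = nonassoc_algebra +
  assumes ex_natural_basis: "\<exists>b. natural_basis b"

locale algebra_morphism =
  A: nonassoc_algebra scaleA A mulA + B: nonassoc_algebra scaleB B mulB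
  for scaleA :: "'f::field \<Rightarrow> 'a::ab_group_add \<Rightarrow> 'a" and A mulA
    and scaleB :: "'f \<Rightarrow> 'b::ab_group_add \<Rightarrow> 'b" and B mulB +
  fixes \<phi> :: "'a \<Rightarrow> 'b"
  assumes maps_to: "x \<in> A \<Longrightarrow> \<phi> x \<in> B"
    and map_add: "\<lbrakk>x \<in> A; y \<in> A\<rbrakk> \<Longrightarrow> \<phi> (x + y) = \<phi> x + \<phi> y"
    and map_scale: "x \<in> A \<Longrightarrow> \<phi> (scaleA c x) = scaleB c (\<phi> x)"
    and map_mul: "\<lbrakk>x \<in> A; y \<in> A\<rbrakk> \<Longrightarrow> \<phi> (mulA x y) = mulB (\<phi> x) (\<phi> y)"

text \<open>
  Degeneracy takes the carrier, product and zero explicitly so that it applies to quotients, whose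
  elements are cosets and thus do not live in a type of class \<open>ab_group_add\<close>.
\<close>

definition degenerate :: "'c set \<Rightarrow> ('c \<Rightarrow> 'c \<Rightarrow> 'c) \<Rightarrow> 'c \<Rightarrow> bool" where
  "degenerate C m z \<longleftrightarrow> (\<forall>x\<in>C. \<forall>y\<in>C. m x y = z)"

context nonassoc_algebra
begin

text \<open>The zero of the quotient by \<open>I\<close> is the coset \<open>0 + I = I\<close>.\<close>

definition degenerate_quotient :: "'v set \<Rightarrow> bool" where
  "degenerate_quotient I \<longleftrightarrow> degenerate (quot_carrier I) (quot_mul I) I"

lemma quot_mul_coset:
  assumes I: "ideal I" and x: "x \<in> A" and y: "y \<in> A"
  shows "quot_mul I ((+) x ` I) ((+) y ` I) = (+) (x \<bullet> y) ` I"
proof -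
  have sub: "subspace I" and IA: "I \<subseteq> A"
    and l: "\<And>a i. a \<in> A \<Longrightarrow> i \<in> I \<Longrightarrow> a \<bullet> i \<in> I" and r: "\<And>a i. a \<in> A \<Longrightarrow> i \<in> I \<Longrightarrow> i \<bullet> a \<in> I"
    using I unfolding ideal_def by auto
  have shift: "(+) (a + i) ` I = (+) a ` I" if i: "i \<in> I" for a i
  proof (intro equalityI subsetI)
    fix v assume "v \<in> (+) (a + i) ` I"
    then obtain k where k: "k \<in> I" "v = a + (i + k)" by (auto simp: add.assoc)
    then show "v \<in> (+) a ` I" using subspace_add[OF sub i] by blast
  next
    fix v assume "v \<in> (+) a ` I"
    then obtain k where k: "k \<in> I" "v = (a + i) + (k - i)" by auto
    then show "v \<in> (+) (a + i) ` I" using subspace_diff[OF sub _ i] by blast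
  qed
  have prod: "(+) ((x + i) \<bullet> (y + j)) ` I = (+) (x \<bullet> y) ` I" if i: "i \<in> I" and j: "j \<in> I" for i j
  proof -
    have iA: "i \<in> A" and jA: "j \<in> A" using i j IA by auto
    have "(x + i) \<bullet> (y + j) = (x + i) \<bullet> y + (x + i) \<bullet> j"
      using mul_add_right subspace_add[OF subspace_carrier x iA] y jA by blast
    also have "\<dots> = x \<bullet> y + (i \<bullet> y + (x + i) \<bullet> j)"
      using mul_add_left[OF x iA y] by (simp add: add.assoc)
    finally have e: "(x + i) \<bullet> (y + j) = x \<bullet> y + (i \<bullet> y + (x + i) \<bullet> j)" .
    have "i \<bullet> y + (x + i) \<bullet> j \<in> I"
      by (intro subspace_add[OF sub] r[OF y i] l[OF subspace_add[OF subspace_carrier x iA] j])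
    then show ?thesis using shift e by simp
  qed
  have ne: "I \<noteq> {}" using subspace_0[OF sub] by auto
  have "quot_mul I ((+) x ` I) ((+) y ` I) = (\<Union>i\<in>I. \<Union>j\<in>I. (+) ((x + i) \<bullet> (y + j)) ` I)"
    unfolding quot_mul_def by auto
  also have "\<dots> = (\<Union>i\<in>I. \<Union>j\<in>I. (+) (x \<bullet> y) ` I)"
    using prod by auto
  finally show ?thesis using ne by simp
qed

end

end

theory Submission
  imports Defs
begin

text \<open>
  Let \<open>a\<^sub>0, \<dots>, a\<^sub>n\<^sub>-\<^sub>1\<close> be a multiplicative basis of \<open>A\<close>. Take \<open>B\<close> with natural basis \<open>e\<^sub>p\<^sub>q\<close>, where
  \<open>p, q < n\<close>, and send \<open>a\<^sub>i\<close> to the sum of \<open>e\<^sub>i\<^sub>i\<close>, of \<open>e\<^sub>i\<^sub>j + e\<^sub>j\<^sub>i\<close> for \<open>i < j\<close>, and of \<open>e\<^sub>j\<^sub>i - e\<^sub>i\<^sub>j\<close> for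
  \<open>j < i\<close>. Put \<open>e\<^sub>i\<^sub>i\<^sup>2 = \<phi> (a\<^sub>i\<^sup>2)\<close> and, for \<open>i < j\<close>, \<open>e\<^sub>i\<^sub>j\<^sup>2 = - e\<^sub>j\<^sub>i\<^sup>2 = \<phi> (a\<^sub>i a\<^sub>j) / 2\<close>. The squares
  \<open>e\<^sub>i\<^sub>j\<^sup>2\<close> and \<open>e\<^sub>j\<^sub>i\<^sup>2\<close> cancel in \<open>\<phi> (a\<^sub>i)\<^sup>2\<close> and add up in \<open>\<phi> (a\<^sub>i) \<phi> (a\<^sub>j)\<close>, so \<open>\<phi>\<close> is multiplicative. All
  products of \<open>B\<close> lie in \<open>\<phi> (A)\<close>, and replacing each \<open>e\<^sub>i\<^sub>i\<close> by \<open>\<phi> (a\<^sub>i)\<close> gives a multiplicative basis.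
\<close>

section \<open>Evolution algebras with given squares of the unit vectors\<close>

definition fun_scale :: "'f::field \<Rightarrow> (nat \<Rightarrow> 'f) \<Rightarrow> nat \<Rightarrow> 'f" where
  "fun_scale c f = (\<lambda>k. c * f k)"

lemma fun_scale_apply [simp]: "fun_scale c f k = c * f k"
  by (simp add: fun_scale_def)

lemma sum_fun_apply: "(\<Sum>i\<in>I. f i) k = (\<Sum>i\<in>I. f i k)"
  for f :: "'i \<Rightarrow> nat \<Rightarrow> 'f::comm_monoid_add"
  by (induction I rule: infinite_finite_induct) auto

interpretation fn: vector_space "fun_scale :: 'f::field \<Rightarrow> _"
  by unfold_locales (auto simp: fun_eq_iff algebra_simps)

text \<open>Modelling the space of dimension \<open>N\<close> inside one fixed function type keeps
  \<open>N\<close> a variable, as is needed for dimension \<open>n * n\<close>.\<close>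

definition fin_fun :: "nat \<Rightarrow> (nat \<Rightarrow> 'f::field) set" where
  "fin_fun N = {f. \<forall>k\<ge>N. f k = 0}"

definition unit_fun :: "nat \<Rightarrow> nat \<Rightarrow> 'f::field" where
  "unit_fun k = (\<lambda>m. of_bool (m = k))"

text \<open>\<open>w m\<close> is the prescribed square of \<open>unit_fun m\<close>; distinct unit
  vectors multiply to zero.\<close>

definition evo_mul :: "nat \<Rightarrow> (nat \<Rightarrow> nat \<Rightarrow> 'f::field) \<Rightarrow> (nat \<Rightarrow> 'f) \<Rightarrow> (nat \<Rightarrow> 'f) \<Rightarrow> nat \<Rightarrow> 'f"
  where "evo_mul N w x y = (\<Sum>m<N. fun_scale (x m * y m) (w m))"

lemma evo_mul_apply: "evo_mul N w x y k = (\<Sum>m<N. x m * y m * w m k)"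
  by (simp add: evo_mul_def sum_fun_apply)

lemma subspace_fin_fun: "fn.subspace (fin_fun N)"
  by (auto simp: fn.subspace_def fin_fun_def)

lemma inj_unit_fun: "inj (unit_fun :: nat \<Rightarrow> nat \<Rightarrow> 'f::field)"
  unfolding unit_fun_def inj_def fun_eq_iff by (metis of_bool_eq_iff)

lemma card_unit_fun: "card (unit_fun ` {..<N} :: (nat \<Rightarrow> 'f::field) set) = N"
  using inj_unit_fun by (metis card_image card_lessThan inj_on_subset subset_UNIV)

lemma unit_fun_in_fin_fun: "k < N \<Longrightarrow> unit_fun k \<in> fin_fun N"
  by (auto simp: unit_fun_def fin_fun_def)

lemma fin_fun_expand: "f \<in> fin_fun N \<Longrightarrow> f = (\<Sum>k<N. fun_scale (f k) (unit_fun k))"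
  by (auto simp: fun_eq_iff sum_fun_apply unit_fun_def fin_fun_def of_bool_def if_distrib
      cong: if_cong)

lemma span_unit_fun: "fn.span (unit_fun ` {..<N}) = (fin_fun N :: (nat \<Rightarrow> 'f::field) set)"
proof
  show "fn.span (unit_fun ` {..<N}) \<subseteq> (fin_fun N :: (nat \<Rightarrow> 'f) set)"
    by (rule fn.span_minimal) (auto simp: subspace_fin_fun unit_fun_in_fin_fun)
  show "fin_fun N \<subseteq> (fn.span (unit_fun ` {..<N}) :: (nat \<Rightarrow> 'f) set)"
  proof
    fix f :: "nat \<Rightarrow> 'f" assume "f \<in> fin_fun N"
    moreover have "(\<Sum>k<N. fun_scale (f k) (unit_fun k)) \<in> fn.span (unit_fun ` {..<N})"
      by (intro fn.span_sum fn.span_scale fn.span_base imageI) simp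
    ultimately show "f \<in> fn.span (unit_fun ` {..<N})"
      using fin_fun_expand by metis
  qed
qed

lemma independent_unit_fun: "fn.independent (unit_fun ` {..<N} :: (nat \<Rightarrow> 'f::field) set)"
proof (rule fn.independent_if_scalars_zero)
  fix c :: "(nat \<Rightarrow> 'f) \<Rightarrow> 'f" and x :: "nat \<Rightarrow> 'f"
  assume s: "(\<Sum>v\<in>unit_fun ` {..<N}. fun_scale (c v) v) = 0" and "x \<in> unit_fun ` {..<N}"
  then obtain k where k: "k < N" "x = unit_fun k" by auto
  have "0 = (\<Sum>m<N. fun_scale (c (unit_fun m)) (unit_fun m)) k"
    using s by (simp add: sum.reindex[OF inj_on_subset[OF inj_unit_fun]])
  also have "\<dots> = c x"
    using k by (simp add: sum_fun_apply unit_fun_def of_bool_def if_distrib cong: if_cong)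
  finally show "c x = 0" by simp
qed simp

lemma evo_mul_in_subspace:
  assumes "fn.subspace S" and "\<And>m. m < N \<Longrightarrow> w m \<in> S"
  shows "evo_mul N w x y \<in> S"
  unfolding evo_mul_def using assms by (auto intro!: fn.subspace_sum fn.subspace_scale)

lemma evo_mul_unit_right: "k < N \<Longrightarrow> evo_mul N w x (unit_fun k) = fun_scale (x k) (w k)"
  by (auto simp: fun_eq_iff evo_mul_apply unit_fun_def of_bool_def if_distrib if_distribR
      cong: if_cong)

lemma evo_mul_commute: "evo_mul N w x y = evo_mul N w y x"
  by (simp add: evo_mul_def mult.commute)

lemma evo_mul_bilinear:
  "evo_mul N w (x + y) z = evo_mul N w x z + evo_mul N w y z"
  "evo_mul N w x (y + z) = evo_mul N w x y + evo_mul N w x z"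
  "evo_mul N w (fun_scale c x) y = fun_scale c (evo_mul N w x y)"
  "evo_mul N w x (fun_scale c y) = fun_scale c (evo_mul N w x y)"
  by (auto simp: fun_eq_iff evo_mul_apply sum.distrib sum_distrib_left algebra_simps)

lemma nonassoc_algebra_evo_mul:
  assumes "\<And>m. m < N \<Longrightarrow> w m \<in> fin_fun N"
  shows "nonassoc_algebra fun_scale (fin_fun N) (evo_mul N w)"
  by unfold_locales
    (auto simp: evo_mul_bilinear subspace_fin_fun intro: evo_mul_in_subspace assms)

lemma is_basis_unit_fun:
  "nonassoc_algebra.is_basis (fun_scale :: 'f::field \<Rightarrow> _) (fin_fun N) (unit_fun ` {..<N})"
proof -
  \<comment> \<open>\<open>is_basis\<close> refers only to the scaling and the carrier, so the zero
    product serves to unfold it.\<close>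
  interpret nonassoc_algebra "fun_scale :: 'f \<Rightarrow> _" "fin_fun N" "evo_mul N (\<lambda>_ _. 0)"
    by (rule nonassoc_algebra_evo_mul) (simp add: fin_fun_def)
  show ?thesis
    unfolding is_basis_def by (auto simp: span_unit_fun independent_unit_fun unit_fun_in_fin_fun)
qed

lemma evolution_algebra_evo_mul:
  assumes w: "\<And>m. m < N \<Longrightarrow> w m \<in> fin_fun N"
  shows "evolution_algebra fun_scale (fin_fun N) (evo_mul N w)"
proof -
  interpret nonassoc_algebra fun_scale "fin_fun N" "evo_mul N w"
    using nonassoc_algebra_evo_mul w by blast
  have "natural_basis (unit_fun ` {..<N})"
    unfolding natural_basis_def using is_basis_unit_fun[of N]
    by (auto simp: evo_mul_unit_right) (auto simp: unit_fun_def fun_eq_iff)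
  then show ?thesis by unfold_locales blast
qed

lemma has_dimension_fin_fun:
  "nonassoc_algebra.has_dimension (fun_scale :: 'f::field \<Rightarrow> _) (fin_fun N) N"
proof -
  interpret nonassoc_algebra "fun_scale :: 'f \<Rightarrow> _" "fin_fun N" "evo_mul N (\<lambda>_ _. 0)"
    by (rule nonassoc_algebra_evo_mul) (simp add: fin_fun_def)
  show ?thesis
    unfolding has_dimension_def using is_basis_unit_fun card_unit_fun by blast
qed

text \<open>A maximal independent subset \<open>d\<close> of \<open>c\<close> still spans, so it has
  at least as many elements as there are unit vectors. The bound on \<open>card c\<close> then
  forces \<open>d = c\<close>.\<close>

lemma independent_of_card_le_spanning:
  assumes fin: "finite c" and card: "card c \<le> N" and span: "fin_fun N \<subseteq> fn.span c"
  shows "fn.independent (c :: (nat \<Rightarrow> 'f::field) set)"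
proof -
  obtain d where d: "d \<subseteq> c" "fn.independent d" "c \<subseteq> fn.span d"
    by (rule fn.maximal_independent_subset)
  have fd: "finite d" using d(1) fin finite_subset by blast
  have "fin_fun N \<subseteq> fn.span d"
    using span d(3) fn.span_minimal[OF d(3)] by auto
  then have "unit_fun ` {..<N} \<subseteq> fn.span d"
    using unit_fun_in_fin_fun by blast
  then have "card (unit_fun ` {..<N} :: (nat \<Rightarrow> 'f) set) \<le> card d"
    using fn.independent_span_bound[OF fd independent_unit_fun] by blast
  then have "N \<le> card d"
    by (simp add: card_unit_fun)
  then have "d = c" using card card_seteq[OF fin d(1)] by linarith
  then show ?thesis using d(2) by simp
qed

section \<open>The embedding\<close>

definition pair_sign :: "nat \<Rightarrow> nat \<Rightarrow> 'f::field" where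
  "pair_sign p q = (if p < q then 1 else if p = q then 0 else -1)"

definition pair_weight :: "nat \<Rightarrow> nat \<Rightarrow> 'f::field" where
  "pair_weight p q = (if p < q then 1/2 else if p = q then 1 else -1/2)"

text \<open>This is one coordinate of the multiplicativity of the embedding, with
  \<open>G p q\<close> in the role of the image of the product of basis vectors \<open>p\<close> and
  \<open>q\<close>. For distinct \<open>i\<close>, \<open>j\<close> only the mixed terms at
  \<open>(i, j)\<close> and \<open>(j, i)\<close> survive, and sign times weight is 1/2 at both. For
  \<open>i = j\<close> the mixed terms vanish because the sign is 0 on the diagonal.\<close>

lemma symmetric_sum_pair_weight:
  fixes G :: "nat \<Rightarrow> nat \<Rightarrow> 'f::field"
  assumes two: "(2::'f) \<noteq> 0" and sym: "\<And>p q. G p q = G q p" and i: "i < n" and j: "j < n"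
  shows "(\<Sum>p<n. \<Sum>q<n. (of_bool (i = q) + pair_sign p q * of_bool (i = p)) *
      (of_bool (j = q) + pair_sign p q * of_bool (j = p)) * (pair_weight p q * G p q)) = G i j"
    (is "?S = _")
proof -
  let ?s = "pair_sign :: nat \<Rightarrow> nat \<Rightarrow> 'f" and ?w = "pair_weight :: nat \<Rightarrow> nat \<Rightarrow> 'f"
  let ?h = "\<lambda>p q. ?w p q * G p q"
  \<comment> \<open>Off the diagonal the weight is antisymmetric and the sign squares to 1, so the
    two terms cancel; at \<open>p = i\<close> the weight 1 remains.\<close>
  have diag: "of_bool (i = j) * (?h p i + ?s i p * ?s i p * ?h i p)
      = (if p = i then of_bool (i = j) * G i i else 0)" for p
    using two sym[of p i] by (auto simp: pair_sign_def pair_weight_def field_simps)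
  have "?S = (\<Sum>p<n. \<Sum>q<n.
        (if q = i then of_bool (i = j) * ?h p q else 0)
      + (if p = j then if q = i then ?s p q * ?h p q else 0 else 0)
      + (if p = i then if q = j then ?s p q * ?h p q else 0 else 0)
      + (if p = i then of_bool (i = j) * (?s p q * ?s p q * ?h p q) else 0))"
    by (intro sum.cong refl) (auto simp: algebra_simps)
  also have "\<dots> = (\<Sum>p<n. of_bool (i = j) * ?h p i) + ?s j i * ?h j i + ?s i j * ?h i j
      + (\<Sum>q<n. of_bool (i = j) * (?s i q * ?s i q * ?h i q))"
  proof -
    \<comment> \<open>Conditions on the outer index are pulled out of the inner sum, so that both
      sums collapse.\<close>
    have r: "(\<Sum>q<n. if P then f q else 0) = (if P then \<Sum>q<n. f q else 0)"
      for P and f :: "nat \<Rightarrow> 'f" by simp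
    show ?thesis using i j by (simp add: sum.distrib r)
  qed
  also have "\<dots> = (\<Sum>p<n. of_bool (i = j) * (?h p i + ?s i p * ?s i p * ?h i p))
      + (?s j i * ?h j i + ?s i j * ?h i j)"
    by (simp add: sum.distrib algebra_simps)
  also have "\<dots> = of_bool (i = j) * G i i + (?s j i * ?h j i + ?s i j * ?h i j)"
    unfolding diag using i by simp
  also have "\<dots> = G i j"
    using two sym[of j i] by (auto simp: pair_sign_def pair_weight_def field_simps)
  finally show ?thesis .
qed

section \<open>Numbering of index pairs by quotient and remainder\<close>

lemma pair_index_less: "i < n \<Longrightarrow> j < n \<Longrightarrow> i * n + j < n * n" for i j n :: nat
  using mult_le_mono1[of "Suc i" n n] by simp

lemma div_mod_less: "k < n * n \<Longrightarrow> k div n < n \<and> k mod n < n" for k n :: nat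
  by (cases "n = 0") (auto simp: less_mult_imp_div_less)

lemma sum_div_mod: "(\<Sum>k<n * n. f (k div n) (k mod n)) = (\<Sum>p<n. \<Sum>q<n. f p q)"
  for f :: "nat \<Rightarrow> nat \<Rightarrow> 'f::comm_monoid_add"
proof -
  have "(\<Sum>p<n. \<Sum>q<n. f p q) = (\<Sum>z\<in>{..<n} \<times> {..<n}. f (fst z) (snd z))"
    by (simp add: sum.cartesian_product case_prod_unfold)
  also have "\<dots> = (\<Sum>k<n * n. f (k div n) (k mod n))"
    by (rule sum.reindex_bij_witness[of _ "\<lambda>k. (k div n, k mod n)" "\<lambda>z. fst z * n + snd z"])
      (auto simp: div_mod_less pair_index_less)
  finally show ?thesis by simp
qed

text \<open>Signs and weights compare indices, so the multiplicative basis is fixed together with an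
  enumeration.\<close>

locale multiplicative_enumeration = commutative_algebra +
  fixes a :: "nat \<Rightarrow> 'b" and n :: nat
  assumes two_nonzero: "(2::'a) \<noteq> 0"
    and inj_a: "inj_on a {..<n}"
    and mult_basis: "multiplicative_basis (a ` {..<n})"
begin

abbreviation "bas \<equiv> a ` {..<n}"

text \<open>The unit vector with index \<open>k\<close> plays the role of \<open>e\<^sub>p\<^sub>q\<close> for \<open>p = k div n\<close>, \<open>q = k mod n\<close>.\<close>

definition image_vec :: "nat \<Rightarrow> nat \<Rightarrow> 'a" where
  "image_vec i = (\<lambda>k. if k < n * n
     then of_bool (i = k mod n) + pair_sign (k div n) (k mod n) * of_bool (i = k div n) else 0)"

definition emb :: "'b \<Rightarrow> nat \<Rightarrow> 'a" where
  "emb x = (\<Sum>i<n. fun_scale (representation bas x (a i)) (image_vec i))"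

definition sq :: "nat \<Rightarrow> nat \<Rightarrow> 'a" where
  "sq k = fun_scale (pair_weight (k div n) (k mod n)) (emb (a (k div n) \<bullet> a (k mod n)))"

text \<open>Squares of unit vectors are multiples of images of basis vectors, so these images must
  enter a multiplicative basis. \<open>image_vec i\<close> can replace the diagonal unit vector of
  \<open>(i, i)\<close>, since this is the only diagonal position where it is nonzero.\<close>

definition target_vec :: "nat \<Rightarrow> nat \<Rightarrow> 'a" where
  "target_vec k = (if k div n = k mod n then image_vec (k div n) else unit_fun k)"

section \<open>The embedding: linearity, injectivity, multiplicativity\<close>

lemma indep: "independent bas" and span_bas: "span bas = A" and bas_sub: "bas \<subseteq> A"
  using mult_basis unfolding multiplicative_basis_def is_basis_def by auto

lemma image_vec_in: "image_vec i \<in> fin_fun (n * n)"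
  by (simp add: image_vec_def fin_fun_def)

lemma emb_in: "emb x \<in> fin_fun (n * n)"
  unfolding emb_def
  by (intro fn.subspace_sum fn.subspace_scale subspace_fin_fun image_vec_in)

lemma sq_in: "sq k \<in> fin_fun (n * n)"
  unfolding sq_def by (intro fn.subspace_scale subspace_fin_fun emb_in)

lemma emb_add: "x \<in> A \<Longrightarrow> y \<in> A \<Longrightarrow> emb (x + y) = emb x + emb y"
  using indep span_bas
  by (simp add: emb_def representation_add fn.scale_left_distrib sum.distrib)

lemma emb_scale: "x \<in> A \<Longrightarrow> emb (c *s x) = fun_scale c (emb x)"
  using indep span_bas
  by (simp add: emb_def representation_scale fn.scale_sum_right)

lemma emb_basis: "i < n \<Longrightarrow> emb (a i) = image_vec i"
proof -
  assume i: "i < n"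
  have "representation bas (a i) (a m) = of_bool (m = i)" if "m < n" for m
    using representation_basis[OF indep, of "a i"] i that inj_on_eq_iff[OF inj_a, of i m]
    by auto
  then have "emb (a i) = (\<Sum>m<n. if m = i then image_vec m else 0)"
    unfolding emb_def by (intro sum.cong) auto
  then show ?thesis using i by simp
qed

text \<open>On the diagonal the sign term vanishes, so the diagonal coordinates of
  \<open>emb x\<close> are the coordinates of \<open>x\<close>. Injectivity follows from
  this.\<close>

lemma emb_diagonal:
  assumes i: "i < n"
  shows "emb x (i * n + i) = representation bas x (a i)"
proof -
  have "i * n + i < n * n" by (rule pair_index_less[OF i i])
  then have diag: "image_vec m (i * n + i) = (if m = i then 1 else 0)" for m
    using i by (auto simp: image_vec_def pair_sign_def)
  show ?thesis
    using i by (simp add: emb_def sum_fun_apply diag if_distrib cong: if_cong)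
qed

lemma inj_emb: "inj_on emb A"
proof (rule inj_onI)
  fix x y assume x: "x \<in> A" and y: "y \<in> A" and eq: "emb x = emb y"
  have rep: "representation bas x v = representation bas y v" if "v \<in> bas" for v
    using that emb_diagonal[of _ x] emb_diagonal[of _ y] eq by auto
  have "z = (\<Sum>v\<in>bas. representation bas z v *s v)" if "z \<in> A" for z
    using sum_representation_eq[OF indep, of z bas] that span_bas by simp
  from this[OF x] this[OF y] rep show "x = y" by simp
qed

lemma emb_mul_basis:
  assumes i: "i < n" and j: "j < n"
  shows "emb (a i \<bullet> a j) = evo_mul (n * n) sq (image_vec i) (image_vec j)"
proof
  fix k
  \<comment> \<open>The summation lemma asks for symmetry at all indices, while commutativity is
    available only for basis vectors; the default 0 closes the gap.\<close>
  let ?G = "\<lambda>p q. if p < n \<and> q < n then emb (a p \<bullet> a q) k else 0"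
  have sym: "?G p q = ?G q p" for p q
  proof -
    have "p < n \<Longrightarrow> q < n \<Longrightarrow> a p \<bullet> a q = a q \<bullet> a p"
      using bas_sub by (intro mul_commute) auto
    then show ?thesis by auto
  qed
  let ?f = "\<lambda>p q. (of_bool (i = q) + pair_sign p q * of_bool (i = p)) *
      (of_bool (j = q) + pair_sign p q * of_bool (j = p)) * (pair_weight p q * ?G p q)"
  have "evo_mul (n * n) sq (image_vec i) (image_vec j) k = (\<Sum>m<n * n. ?f (m div n) (m mod n))"
    unfolding evo_mul_apply by (intro sum.cong) (auto simp: image_vec_def sq_def div_mod_less)
  also have "\<dots> = (\<Sum>p<n. \<Sum>q<n. ?f p q)" by (rule sum_div_mod)
  also have "\<dots> = ?G i j" by (rule symmetric_sum_pair_weight[OF two_nonzero sym i j])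
  finally show "emb (a i \<bullet> a j) k = evo_mul (n * n) sq (image_vec i) (image_vec j) k"
    using i j by simp
qed

lemma emb_mul:
  assumes x: "x \<in> A" and y: "y \<in> A"
  shows "emb (x \<bullet> y) = evo_mul (n * n) sq (emb x) (emb y)"
proof -
  note closed = subspace_add[OF subspace_carrier] subspace_scale[OF subspace_carrier]
  have zero: "emb 0 = 0" using emb_scale[OF subspace_0[OF subspace_carrier], of 0] by simp
  have z: "0 \<bullet> y = 0" "y \<bullet> 0 = 0" if "y \<in> A" for y
    using mul_scale_left[OF subspace_0[OF subspace_carrier] that, of 0]
      mul_scale_right[OF that subspace_0[OF subspace_carrier], of 0] by auto
  have z': "evo_mul N w 0 y = 0" "evo_mul N w y 0 = 0"
    for N w and y :: "nat \<Rightarrow> 'a" by (auto simp: fun_eq_iff evo_mul_apply)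
  have step_basis: "emb (u \<bullet> y) = evo_mul (n * n) sq (emb u) (emb y)" if u: "u \<in> bas" for u
  proof -
    have uA: "u \<in> A" using u bas_sub by blast
    \<comment> \<open>Membership in \<open>A\<close> is carried through the induction because
      bilinearity holds only on \<open>A\<close>.\<close>
    have "y \<in> A \<and> emb (u \<bullet> y) = evo_mul (n * n) sq (emb u) (emb y)"
      using y unfolding span_bas[symmetric]
    proof (induction rule: span_induct_alt)
      case base
      show ?case by (simp only: z(2)[OF uA] zero z' span_zero simp_thms)
    next
      case (step c v y)
      have v: "v \<in> A" and y: "y \<in> A" using step bas_sub span_bas by auto
      have "emb (u \<bullet> v) = evo_mul (n * n) sq (emb u) (emb v)"
        using emb_mul_basis u step(1) by (auto simp: emb_basis)
      then show ?case
        using step v y uA closed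
        by (simp only: span_bas mul_add_right mul_scale_right emb_add emb_scale
            evo_mul_bilinear mul_closed simp_thms)
    qed
    then show ?thesis by simp
  qed
  have "x \<in> A \<and> emb (x \<bullet> y) = evo_mul (n * n) sq (emb x) (emb y)"
    using x unfolding span_bas[symmetric]
  proof (induction rule: span_induct_alt)
    case base
    show ?case by (simp only: z(1)[OF y] zero z' span_zero simp_thms)
  next
    case (step c v x)
    have v: "v \<in> A" and x: "x \<in> A" using step bas_sub span_bas by auto
    then show ?case
      using step v y step_basis closed
      by (simp only: span_bas mul_add_left mul_scale_left emb_add emb_scale
            evo_mul_bilinear mul_closed simp_thms)
  qed
  then show ?thesis by simp
qed

sublocale target: evolution_algebra fun_scale "fin_fun (n * n)" "evo_mul (n * n) sq"
  by (rule evolution_algebra_evo_mul) (rule sq_in)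

sublocale morphism: algebra_morphism scale A mul fun_scale "fin_fun (n * n)" "evo_mul (n * n) sq" emb
  by unfold_locales (auto simp: emb_in emb_add emb_scale emb_mul)

section \<open>The image as an ideal with degenerate quotient\<close>

lemma subspace_image: "fn.subspace (emb ` A)"
proof -
  have "emb 0 = 0" using emb_scale[OF subspace_0[OF subspace_carrier], of 0] by simp
  then show ?thesis
    using subspace_carrier unfolding fn.subspace_def subspace_def
    by (force simp: emb_add[symmetric] emb_scale[symmetric])
qed

text \<open>Every product is a combination of the squares \<open>sq m\<close>, which lie in the
  image. This yields both the ideal property and degeneracy of the quotient.\<close>

lemma target_mul_in_image: "evo_mul (n * n) sq x y \<in> emb ` A"
proof (rule evo_mul_in_subspace[OF subspace_image])
  fix m assume m: "m < n * n"
  then have "m div n < n" "m mod n < n"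
    by (auto dest: div_mod_less)
  then have "a (m div n) \<bullet> a (m mod n) \<in> A"
    using bas_sub by (intro mul_closed) auto
  then show "sq m \<in> emb ` A"
    unfolding sq_def by (intro fn.subspace_scale subspace_image imageI)
qed

lemma ideal_image: "target.ideal (emb ` A)"
  unfolding target.ideal_def using emb_in subspace_image target_mul_in_image by auto

lemma degenerate_quotient_image: "target.degenerate_quotient (emb ` A)"
proof -
  have "(+) z ` (emb ` A) = emb ` A" if "z \<in> emb ` A" for z
  proof (intro equalityI subsetI)
    fix v assume "v \<in> emb ` A"
    then have "v - z \<in> emb ` A" using fn.subspace_diff[OF subspace_image] that by blast
    then show "v \<in> (+) z ` (emb ` A)" by (metis add.commute diff_add_cancel imageI)
  qed (use fn.subspace_add[OF subspace_image that] in auto)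
  then show ?thesis
    unfolding target.degenerate_quotient_def degenerate_def target.quot_carrier_def
    using target.quot_mul_coset[OF ideal_image] target_mul_in_image by auto
qed

section \<open>A multiplicative basis of the target\<close>

lemma unit_fun_in_span_target_vec:
  assumes k: "k < n * n"
  shows "unit_fun k \<in> fn.span (target_vec ` {..<n * n})"
proof (cases "k div n = k mod n")
  case False
  then show ?thesis using k fn.span_base[of "target_vec k"] by (auto simp: target_vec_def)
next
  case True
  \<comment> \<open>Expand \<open>image_vec ?p\<close> in unit vectors: \<open>k\<close> is its only
    diagonal index with nonzero coefficient, namely 1, and the off-diagonal unit vectors are among
    the \<open>target_vec\<close>. So the expansion can be solved for
    \<open>unit_fun k\<close>.\<close>
  let ?S = "fn.span (target_vec ` {..<n * n})"
  let ?p = "k div n" and ?u = "\<lambda>m. fun_scale (image_vec (k div n) m) (unit_fun m)"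
  have p: "?p < n" using k by (rule less_mult_imp_div_less)
  have kp: "k = ?p * n + ?p" using True div_mult_mod_eq[of k n] by simp
  have one: "image_vec ?p k = 1"
    using k True by (simp add: image_vec_def pair_sign_def)
  have other: "?u m \<in> ?S" if m: "m < n * n" "m \<noteq> k" for m
  proof (cases "m div n = m mod n")
    case True
    then have "m div n \<noteq> ?p" using m(2) kp div_mult_mod_eq[of m n] by metis
    then have "image_vec ?p m = 0" using True by (auto simp: image_vec_def pair_sign_def)
    then show ?thesis by (simp add: fn.span_zero)
  next
    case False
    then have "unit_fun m \<in> ?S"
      using m fn.span_base[of "target_vec m"] by (auto simp: target_vec_def)
    then show ?thesis by (rule fn.span_scale)
  qed
  have "image_vec ?p = (\<Sum>m<n * n. ?u m)" by (rule fin_fun_expand[OF image_vec_in])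
  also have "\<dots> = unit_fun k + (\<Sum>m\<in>{..<n * n} - {k}. ?u m)"
    using k one by (subst sum.remove[of _ k]) auto
  finally have "unit_fun k = image_vec ?p - (\<Sum>m\<in>{..<n * n} - {k}. ?u m)"
    unfolding eq_diff_eq by (rule sym)
  moreover have "image_vec ?p \<in> ?S"
    using k True fn.span_base[of "target_vec k"] by (auto simp: target_vec_def)
  moreover have "(\<Sum>m\<in>{..<n * n} - {k}. ?u m) \<in> ?S"
    using other by (auto intro: fn.span_sum)
  ultimately show ?thesis using fn.span_diff by metis
qed

lemma is_basis_target_vec: "target.is_basis (target_vec ` {..<n * n})"
proof -
  let ?c = "target_vec ` {..<n * n}"
  have sub: "?c \<subseteq> fin_fun (n * n)"
    by (auto simp: target_vec_def image_vec_in unit_fun_in_fin_fun)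
  have "fn.span (unit_fun ` {..<n * n}) \<subseteq> fn.span ?c"
    by (rule fn.span_minimal) (auto simp: unit_fun_in_span_target_vec)
  then have sp: "fin_fun (n * n) \<subseteq> fn.span ?c" by (simp add: span_unit_fun)
  \<comment> \<open>The set has at most \<open>n * n\<close> members and spans, so counting gives
    independence.\<close>
  have "fn.independent ?c"
    using card_image_le[of "{..<n * n}" target_vec]
    by (intro independent_of_card_le_spanning[OF _ _ sp]) auto
  then show ?thesis
    unfolding target.is_basis_def using sub sp fn.span_minimal[OF sub subspace_fin_fun] by auto
qed

lemma image_vec_target: "i < n \<Longrightarrow> image_vec i \<in> target_vec ` {..<n * n}"
  by (rule image_eqI[of _ _ "i * n + i"]) (auto simp: target_vec_def pair_index_less)

lemma emb_mul_basis_multiple: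
  assumes i: "i < n" and j: "j < n"
  shows "\<exists>z\<in>target_vec ` {..<n * n}. \<exists>c. emb (a i \<bullet> a j) = fun_scale c z"
proof -
  obtain l c where l: "l < n" "a i \<bullet> a j = c *s a l"
    using mult_basis i j unfolding multiplicative_basis_def by blast
  then have "emb (a i \<bullet> a j) = fun_scale c (image_vec l)"
    using emb_scale[of "a l" c] bas_sub by (auto simp: emb_basis)
  then show ?thesis using image_vec_target l(1) by blast
qed

text \<open>Multiplying by a unit vector keeps one coordinate of \<open>x\<close>, so the product is
  a multiple of \<open>sq k\<close>, hence of the image of a product of two basis vectors.\<close>

lemma mul_unit_fun_multiple:
  assumes k: "k < n * n"
  shows "\<exists>z\<in>target_vec ` {..<n * n}. \<exists>c. evo_mul (n * n) sq x (unit_fun k) = fun_scale c z"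
proof -
  have "k div n < n" "k mod n < n"
    using div_mod_less[OF k] by auto
  then obtain z c where "z \<in> target_vec ` {..<n * n}"
      "emb (a (k div n) \<bullet> a (k mod n)) = fun_scale c z"
    using emb_mul_basis_multiple by blast
  then show ?thesis using k by (auto simp: evo_mul_unit_right sq_def)
qed

lemma multiplicative_basis_target_vec: "target.multiplicative_basis (target_vec ` {..<n * n})"
proof -
  have "\<exists>z\<in>target_vec ` {..<n * n}. \<exists>c. evo_mul (n * n) sq (target_vec k) (target_vec m) = fun_scale c z"
    if k: "k < n * n" and m: "m < n * n" for k m
  \<comment> \<open>Two diagonal vectors are images of basis vectors, so multiplicativity of
    \<open>emb\<close> applies; otherwise some factor is a unit vector.\<close>
  proof (cases "k div n = k mod n \<and> m div n = m mod n")
    case True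
    moreover have "k div n < n" "m div n < n" using k m by (auto intro: less_mult_imp_div_less)
    ultimately show ?thesis
      using emb_mul_basis_multiple[of "k div n" "m div n"] by (simp add: emb_mul_basis target_vec_def)
  next
    case False
    then consider "target_vec k = unit_fun k" | "target_vec m = unit_fun m"
      by (auto simp: target_vec_def)
    then show ?thesis
    proof cases
      case 1
      then show ?thesis
        using mul_unit_fun_multiple[OF k, of "target_vec m"]
        by (simp only: evo_mul_commute[of _ _ "unit_fun k"])
    next
      case 2
      then show ?thesis
        using mul_unit_fun_multiple[OF m, of "target_vec k"] by simp
    qed
  qed
  then show ?thesis
    unfolding target.multiplicative_basis_def using is_basis_target_vec by blast
qed

end

text \<open>The basis witnessing the dimension need not be the multiplicative one. Each is
  independent in the span of the other, which bounds the cardinalities both ways.\<close>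

lemma (in nonassoc_algebra) card_is_basis:
  assumes "has_dimension n" and b: "is_basis b"
  shows "finite b \<and> card b = n"
proof -
  obtain d where d: "is_basis d" "finite d" "card d = n"
    using assms(1) unfolding has_dimension_def by blast
  have fb: "finite b \<and> card b \<le> n"
    using independent_span_bound[of d b] b d unfolding is_basis_def by auto
  then show ?thesis
    using independent_span_bound[of b d] b d unfolding is_basis_def by auto
qed

theorem theorem6p2:
  fixes scaleA :: "'f::field \<Rightarrow> 'a::ab_group_add \<Rightarrow> 'a"
    and A :: "'a set" and mulA :: "'a \<Rightarrow> 'a \<Rightarrow> 'a" and n :: nat
  assumes "CHAR('f) \<noteq> 2"
    and "commutative_algebra scaleA A mulA"
    and "nonassoc_algebra.has_dimension scaleA A n"
    and "\<exists>b. nonassoc_algebra.multiplicative_basis scaleA A mulA b"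
  shows "\<exists>(scaleB :: 'f \<Rightarrow> (nat \<Rightarrow> 'f) \<Rightarrow> (nat \<Rightarrow> 'f)) (B :: (nat \<Rightarrow> 'f) set) mulB \<phi>.
           evolution_algebra scaleB B mulB \<and>
           nonassoc_algebra.has_dimension scaleB B (n^2) \<and>
           (\<exists>b. nonassoc_algebra.multiplicative_basis scaleB B mulB b) \<and>
           algebra_morphism scaleA A mulA scaleB B mulB \<phi> \<and>
           inj_on \<phi> A \<and>
           nonassoc_algebra.ideal scaleB B mulB (\<phi> ` A) \<and>
           nonassoc_algebra.degenerate_quotient B mulB (\<phi> ` A)"
proof -
  interpret A: commutative_algebra scaleA A mulA by fact
  obtain b where b: "A.multiplicative_basis b" using assms(4) by blast
  then have "finite b \<and> card b = n"
    using A.card_is_basis[OF assms(3)] unfolding A.multiplicative_basis_def by blast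
  then obtain a where a: "bij_betw a {..<n} b"
    using ex_bij_betw_nat_finite[of b] by (auto simp: atLeast0LessThan)
  have two: "(2::'f) \<noteq> 0"
  proof
    assume "(2::'f) = 0"
    then have "of_nat 2 = (0::'f)" by simp
    then have dvd: "CHAR('f) dvd 2" by (simp only: of_nat_eq_0_iff_char_dvd)
    then have "CHAR('f) \<le> 2" by (rule dvd_imp_le) simp
    \<comment> \<open>A divisor of 2 is nonzero, and a field does not have characteristic 1; only 2
      would be left.\<close>
    moreover have "CHAR('f) \<noteq> 0" using dvd by (intro notI) simp
    moreover have "CHAR('f) \<noteq> 1" by simp
    ultimately show False using assms(1) by linarith
  qed
  interpret E: multiplicative_enumeration scaleA A mulA a n
    by unfold_locales (use a b two in \<open>auto simp: bij_betw_def\<close>)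
  have "E.target.has_dimension (n^2)"
    unfolding power2_eq_square by (rule has_dimension_fin_fun)
  then show ?thesis
    using E.target.evolution_algebra_axioms E.multiplicative_basis_target_vec
      E.morphism.algebra_morphism_axioms E.inj_emb E.ideal_image E.degenerate_quotient_image
    by blast
qed

end
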